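(* For all integers $s > r \ge 2$, we have $\mathrm{ssat}(n, K_r, K_s) = n\binom{s-2}{r-1} - o(n)$ as $n \to \infty$.
   Context: A graph $G$ is strongly $F$-saturated if adding any edge (between two non-adjacent vertices) to $G$ creates a new copy of $F$; $G$ is not required to be $F$-free. $\mathrm{ssat}(n,H,F)$ denotes the minimum number of copies of $H$ in an $n$-vertex strongly $F$-saturated graph. $K_t$ denotes the complete graph on $t$ vertices. *)

theory Defs
  imports Complex_Main "HOL-Library.Ramsey" "HOL-Library.Landau_Symbols"
begin

type_synonym 'a graph = "'a set \<times> 'a set set"

definition simple_graph :: "'a graph \<Rightarrow> bool" where
  "simple_graph G \<longleftrightarrow> finite (fst G) \<and> snd G \<subseteq> [fst G]\<^bsup>2\<^esup>"

definition complete_graph :: "nat \<Rightarrow> nat graph" where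
  "complete_graph t = ({..<t}, [{..<t}]\<^bsup>2\<^esup>)"

definition subgraph :: "'a graph \<Rightarrow> 'a graph \<Rightarrow> bool" where
  "subgraph K G \<longleftrightarrow> simple_graph K \<and> fst K \<subseteq> fst G \<and> snd K \<subseteq> snd G"

definition graph_iso :: "'a graph \<Rightarrow> 'b graph \<Rightarrow> bool" where
  "graph_iso H K \<longleftrightarrow> (\<exists>f. bij_betw f (fst H) (fst K) \<and>
     (\<forall>u\<in>fst H. \<forall>v\<in>fst H. {u, v} \<in> snd H \<longleftrightarrow> {f u, f v} \<in> snd K))"

text \<open>Copies are subgraphs, not necessarily induced, and are counted without labels.\<close>

definition copies :: "'b graph \<Rightarrow> 'a graph \<Rightarrow> 'a graph set" where
  "copies H G = {K. subgraph K G \<and> graph_iso H K}"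

definition add_edge :: "'a \<Rightarrow> 'a \<Rightarrow> 'a graph \<Rightarrow> 'a graph" where
  "add_edge u v G = (fst G, insert {u, v} (snd G))"

definition strongly_saturated :: "'b graph \<Rightarrow> 'a graph \<Rightarrow> bool" where
  "strongly_saturated F G \<longleftrightarrow>
     (\<forall>u\<in>fst G. \<forall>v\<in>fst G. u \<noteq> v \<longrightarrow> {u, v} \<notin> snd G \<longrightarrow>
        (\<exists>K. K \<in> copies F (add_edge u v G) \<and> K \<notin> copies F G))"

text \<open>
  Every finite graph is isomorphic to one with vertices in \<^typ>\<open>nat\<close>, so it suffices to range over
  these. The set below is never empty, since complete graphs are vacuously strongly saturated;
  hence the infimum is a minimum.
\<close>

definition ssat :: "nat \<Rightarrow> 'b graph \<Rightarrow> 'c graph \<Rightarrow> nat" where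
  "ssat n H F = Inf {card (copies H G) | G :: nat graph.
     simple_graph G \<and> card (fst G) = n \<and> strongly_saturated F G}"

lemma ssat_attained:
  "\<exists>G :: nat graph. simple_graph G \<and> card (fst G) = n \<and> strongly_saturated F G \<and>
     card (copies H G) = ssat n H F"
proof -
  let ?S = "{card (copies H G) | G :: nat graph.
     simple_graph G \<and> card (fst G) = n \<and> strongly_saturated F G}"
  have "simple_graph (complete_graph n)" "card (fst (complete_graph n)) = n"
    "strongly_saturated F (complete_graph n)"
    by (auto simp: simple_graph_def complete_graph_def strongly_saturated_def)
  then have "?S \<noteq> {}" by blast
  then have "Inf ?S \<in> ?S" by (rule Inf_nat_def1)
  then show ?thesis unfolding ssat_def by (smt (verit) mem_Collect_eq)
qed

lemma finite_copies:
  assumes "simple_graph G"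
  shows "finite (copies H G)"
proof (rule finite_subset)
  show "copies H G \<subseteq> Pow (fst G) \<times> Pow (snd G)"
    by (auto simp: copies_def subgraph_def)
  have "finite (snd G)"
    using assms finite_imp_finite_nsets finite_subset unfolding simple_graph_def by blast
  then show "finite (Pow (fst G) \<times> Pow (snd G))"
    using assms by (simp add: simple_graph_def)
qed

end

theory Submission
  imports Defs
begin

text \<open>
  The upper bound comes from joining \<open>K\<^bsub>s-2\<^esub>\<close> to an independent set. For the lower bound, fix a
  constant \<open>K\<close> and let \<open>D\<close> be the set of vertices lying in at least \<open>K\<close> copies of \<open>K\<^bsub>r\<^esub>\<close>; by double
  counting, \<open>|D|\<close> is at most \<open>r/K\<close> times the number of copies. If a vertex \<open>v\<close> outside \<open>D\<close> is joined to
  an \<open>(s-2)\<close>-clique inside \<open>D\<close>, it yields \<open>binom(s-2, r-1)\<close> copies whose only vertex outside \<open>D\<close> is \<open>v\<close>, so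
  different \<open>v\<close> contribute disjoint families. Otherwise, for every non-neighbour \<open>u\<close> of \<open>v\<close>, the \<open>(s-2)\<close>-clique
  in the common neighbourhood of \<open>u\<close> and \<open>v\<close> contains some \<open>t\<close> outside \<open>D\<close>, and both \<open>vt\<close> and \<open>tu\<close> lie in
  copies of \<open>K\<^bsub>r\<^esub>\<close>. Hence \<open>v\<close> has boundedly many non-neighbours. There are only boundedly many
  such \<open>v\<close>: a large set of them would be almost complete and so would put its members into many copies.
\<close>

section \<open>Cliques as vertex sets, and copies of complete graphs\<close>

definition is_clique :: "'a graph \<Rightarrow> 'a set \<Rightarrow> bool" where
  "is_clique G X \<longleftrightarrow> X \<subseteq> fst G \<and> (\<forall>x\<in>X. \<forall>y\<in>X. x \<noteq> y \<longrightarrow> {x, y} \<in> snd G)"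

definition cliques :: "nat \<Rightarrow> 'a graph \<Rightarrow> 'a set set" where
  "cliques t G = {X. is_clique G X \<and> card X = t}"

lemma clique_subset: "is_clique G X \<Longrightarrow> Y \<subseteq> X \<Longrightarrow> is_clique G Y"
  unfolding is_clique_def by blast

lemma clique_insert:
  "is_clique G (insert x X) \<longleftrightarrow> x \<in> fst G \<and> is_clique G X \<and> (\<forall>y\<in>X. y \<noteq> x \<longrightarrow> {x, y} \<in> snd G)"
  unfolding is_clique_def by (auto simp: insert_commute)

lemma clique_finite: "simple_graph G \<Longrightarrow> is_clique G X \<Longrightarrow> finite X"
  unfolding simple_graph_def is_clique_def by (auto intro: finite_subset)

lemma finite_cliques: "simple_graph G \<Longrightarrow> finite (cliques t G)"
  by (rule finite_subset[of _ "Pow (fst G)"])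
     (auto simp: cliques_def is_clique_def simple_graph_def)

lemma clique_iff_nsets: "is_clique G X \<longleftrightarrow> X \<subseteq> fst G \<and> [X]\<^bsup>2\<^esup> \<subseteq> snd G"
proof -
  have "{x, y} \<in> [X]\<^bsup>2\<^esup>" if "x \<in> X" "y \<in> X" "x \<noteq> y" for x y
    using that by (simp add: nsets_def)
  moreover have "\<exists>x\<in>X. \<exists>y\<in>X. x \<noteq> y \<and> e = {x, y}" if "e \<in> [X]\<^bsup>2\<^esup>" for e
    using that by (auto simp: nsets_def card_2_iff)
  ultimately show ?thesis unfolding is_clique_def by blast
qed

lemma nsets_2_pair: "{x, y} \<in> [X]\<^bsup>2\<^esup> \<longleftrightarrow> x \<in> X \<and> y \<in> X \<and> x \<noteq> y"
  by (auto simp: nsets_def card_insert_if)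

text \<open>A copy of a complete graph must carry every pair of its vertices as an edge, so its
  vertex set determines it. Counting copies thus reduces to counting vertex sets.\<close>

lemma copies_complete_graph:
  assumes "simple_graph G"
  shows "copies (complete_graph t) G = (\<lambda>X. (X, [X]\<^bsup>2\<^esup>)) ` cliques t G"
proof (intro subset_antisym subsetI)
  fix K assume "K \<in> copies (complete_graph t) G"
  then obtain f where sub: "subgraph K G" and bij: "bij_betw f {..<t} (fst K)"
    and iso: "\<And>u v. u < t \<Longrightarrow> v < t \<Longrightarrow> {u, v} \<in> [{..<t}]\<^bsup>2\<^esup> \<longleftrightarrow> {f u, f v} \<in> snd K"
    unfolding copies_def graph_iso_def complete_graph_def by auto
  have card: "card (fst K) = t"
    using bij_betw_same_card[OF bij] by simp
  have "{x, y} \<in> snd K" if "x \<in> fst K" "y \<in> fst K" "x \<noteq> y" for x y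
  proof -
    have "x \<in> f ` {..<t}" "y \<in> f ` {..<t}"
      using \<open>x \<in> fst K\<close> \<open>y \<in> fst K\<close> bij unfolding bij_betw_def by auto
    then obtain u v where "u < t" "v < t" "x = f u" "y = f v" by auto
    then show ?thesis
      using iso[of u v] \<open>x \<noteq> y\<close> by (auto simp: nsets_2_pair)
  qed
  then have "[fst K]\<^bsup>2\<^esup> \<subseteq> snd K"
    unfolding nsets_def by (auto simp: card_2_iff)
  then have eq: "snd K = [fst K]\<^bsup>2\<^esup>"
    using sub unfolding subgraph_def simple_graph_def by auto
  then have "fst K \<in> cliques t G"
    using sub card unfolding cliques_def clique_iff_nsets subgraph_def by auto
  then show "K \<in> (\<lambda>X. (X, [X]\<^bsup>2\<^esup>)) ` cliques t G"
    using eq by (intro image_eqI[of _ _ "fst K"]) (simp_all add: prod_eq_iff)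
next
  fix K assume "K \<in> (\<lambda>X. (X, [X]\<^bsup>2\<^esup>)) ` cliques t G"
  then obtain X where K: "K = (X, [X]\<^bsup>2\<^esup>)" and "X \<in> cliques t G" by (rule imageE)
  then have X: "is_clique G X" "card X = t" by (simp_all add: cliques_def)
  have fin: "finite X" using clique_finite[OF assms X(1)] .
  then obtain f where f: "bij_betw f {..<t} X"
    using X(2) ex_bij_betw_nat_finite lessThan_atLeast0 by metis
  have "f u = f v \<longleftrightarrow> u = v" if "u < t" "v < t" for u v
    using f that unfolding bij_betw_def inj_on_def by auto
  moreover have "f u \<in> X" if "u < t" for u
    using f that unfolding bij_betw_def by auto
  ultimately have "graph_iso (complete_graph t) K"
    unfolding graph_iso_def complete_graph_def K using f
    by (auto simp: nsets_2_pair intro!: exI[of _ f])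
  moreover have "subgraph K G"
    using X fin unfolding K subgraph_def simple_graph_def clique_iff_nsets by simp
  ultimately show "K \<in> copies (complete_graph t) G"
    unfolding copies_def by simp
qed

lemma card_copies_complete_graph:
  assumes "simple_graph G"
  shows "card (copies (complete_graph t) G) = card (cliques t G)"
  unfolding copies_complete_graph[OF assms] by (intro card_image inj_onI) simp

section \<open>Strong saturation expressed through cliques\<close>

lemma simple_graph_add_edge:
  assumes "simple_graph G" "u \<in> fst G" "v \<in> fst G" "u \<noteq> v"
  shows "simple_graph (add_edge u v G)"
  using assms unfolding simple_graph_def add_edge_def by (simp add: nsets_2_pair)

text \<open>A new copy of the complete graph must use the added edge \<open>{u, v}\<close>, and
  deleting both ends leaves the required \<open>T\<close>. Conversely, \<open>T\<close> together
  with \<open>u\<close> and \<open>v\<close> is a clique only after the edge is added.\<close>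

lemma strongly_saturated_complete_graph_iff:
  assumes G: "simple_graph G" and s: "2 \<le> s"
  shows "strongly_saturated (complete_graph s) G \<longleftrightarrow>
    (\<forall>u\<in>fst G. \<forall>v\<in>fst G. u \<noteq> v \<longrightarrow> {u, v} \<notin> snd G \<longrightarrow>
      (\<exists>T. is_clique G (insert u T) \<and> is_clique G (insert v T) \<and> card T = s - 2 \<and> u \<notin> T \<and> v \<notin> T))"
    (is "_ \<longleftrightarrow> (\<forall>u\<in>fst G. \<forall>v\<in>fst G. _ \<longrightarrow> _ \<longrightarrow> ?R u v)")
  unfolding strongly_saturated_def
proof (intro ball_cong refl imp_cong)
  fix u v assume uv: "u \<in> fst G" "v \<in> fst G" "u \<noteq> v" "{u, v} \<notin> snd G"
  let ?G' = "add_edge u v G"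
  have G': "simple_graph ?G'" using simple_graph_add_edge[OF G] uv by blast
  have clq: "is_clique ?G' X \<longleftrightarrow>
    X \<subseteq> fst G \<and> (\<forall>x\<in>X. \<forall>y\<in>X. x \<noteq> y \<longrightarrow> {x, y} = {u, v} \<or> {x, y} \<in> snd G)" for X
    unfolding is_clique_def add_edge_def by simp
  have "(\<exists>K. K \<in> copies (complete_graph s) ?G' \<and> K \<notin> copies (complete_graph s) G)
    \<longleftrightarrow> (\<exists>X. X \<in> cliques s ?G' \<and> X \<notin> cliques s G)"
    unfolding copies_complete_graph[OF G] copies_complete_graph[OF G'] by auto
  also have "\<dots> \<longleftrightarrow> ?R u v"
  proof
    assume "\<exists>X. X \<in> cliques s ?G' \<and> X \<notin> cliques s G"
    then obtain X where X: "is_clique ?G' X" "card X = s" "\<not> is_clique G X"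
      by (auto simp: cliques_def)
    \<comment> \<open>\<open>X\<close> fails to be a clique of \<open>G\<close>, so one of its pairs
      is the added edge.\<close>
    then have uX: "u \<in> X" and vX: "v \<in> X"
      unfolding clq by (auto simp: is_clique_def doubleton_eq_iff)
    have "is_clique G (insert u (X - {u, v}))" "is_clique G (insert v (X - {u, v}))"
      using X(1)[unfolded clq] uv uX vX unfolding is_clique_def by (auto simp: doubleton_eq_iff)
    moreover have "card (X - {u, v}) = s - 2"
      using uX vX uv X(2) clique_finite[OF G' X(1)] by (simp add: card_Diff_subset)
    ultimately show "?R u v" by blast
  next
    assume "?R u v"
    then obtain T where T: "is_clique G (insert u T)" "is_clique G (insert v T)"
      "card T = s - 2" "u \<notin> T" "v \<notin> T" by blast
    let ?X = "insert u (insert v T)"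
    have "finite T" using clique_finite[OF G T(1)] by simp
    then have "card ?X = s" using T uv s by simp
    moreover have "is_clique ?G' ?X"
      unfolding clq
    proof (intro conjI ballI impI)
      show "?X \<subseteq> fst G" using T(1,2) by (auto simp: is_clique_def)
      fix x y assume xy: "x \<in> ?X" "y \<in> ?X" "x \<noteq> y"
      then consider "x \<in> insert u T" "y \<in> insert u T" | "x \<in> insert v T" "y \<in> insert v T"
        | "{x, y} = {u, v}" by blast
      then show "{x, y} = {u, v} \<or> {x, y} \<in> snd G"
        using T(1,2) xy(3) unfolding is_clique_def by cases blast+
    qed
    moreover have "\<not> is_clique G ?X" using uv unfolding is_clique_def by blast
    ultimately show "\<exists>X. X \<in> cliques s ?G' \<and> X \<notin> cliques s G"
      unfolding cliques_def by blast
  qed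
  finally show "(\<exists>K. K \<in> copies (complete_graph s) ?G' \<and> K \<notin> copies (complete_graph s) G)
    \<longleftrightarrow> ?R u v" .
qed

section \<open>The upper bound\<close>

lemma ssat_complete_graph_upper:
  assumes r: "1 \<le> r" and s: "2 \<le> s"
  shows "ssat n (complete_graph r) (complete_graph s)
    \<le> n * ((s - 2) choose (r - 1)) + ((s - 2) choose r)"
proof -
  let ?C = "{..<s - 2}"
  define G :: "nat graph" where
    "G = ({..<n}, {{x, y} | x y. x < n \<and> y < n \<and> x \<noteq> y \<and> x < s - 2})"
  have V: "fst G = {..<n}" by (simp add: G_def)
  have E: "{x, y} \<in> snd G \<longleftrightarrow> x < n \<and> y < n \<and> x \<noteq> y \<and> (x < s - 2 \<or> y < s - 2)" for x y
    unfolding G_def by (auto simp: doubleton_eq_iff)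
  have G: "simple_graph G"
    unfolding simple_graph_def V by (auto simp: G_def nsets_2_pair)
  have "strongly_saturated (complete_graph s) G"
    unfolding strongly_saturated_complete_graph_iff[OF G s]
  proof (intro ballI impI)
    fix u v assume "u \<in> fst G" "v \<in> fst G" "u \<noteq> v" "{u, v} \<notin> snd G"
    then show "\<exists>T. is_clique G (insert u T) \<and> is_clique G (insert v T) \<and> card T = s - 2 \<and> u \<notin> T \<and> v \<notin> T"
      \<comment> \<open>Non-adjacent distinct \<open>u\<close> and \<open>v\<close> are both at
        least \<open>s - 2\<close>, which also forces \<open>?C\<close> to consist of vertices of
        \<open>G\<close>.\<close>
      by (intro exI[of _ ?C]) (auto simp: V E is_clique_def)
  qed
  then have "ssat n (complete_graph r) (complete_graph s) \<le> card (copies (complete_graph r) G)"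
    unfolding ssat_def using G V
    by (intro cInf_lower CollectI exI[of _ G]) auto
  also have "\<dots> = card (cliques r G)" by (rule card_copies_complete_graph[OF G])
  \<comment> \<open>A clique has at most one vertex outside \<open>?C\<close>. Letting
    \<open>v\<close> run over all vertices instead of those outside \<open>?C\<close> overcounts
    only by a constant.\<close>
  also have "\<dots> \<le> card ((\<lambda>(v, Y). insert v Y) ` ({..<n} \<times> [?C]\<^bsup>(r - 1)\<^esup>) \<union> [?C]\<^bsup>r\<^esup>)"
  proof (rule card_mono)
    show "finite ((\<lambda>(v, Y). insert v Y) ` ({..<n} \<times> [?C]\<^bsup>(r - 1)\<^esup>) \<union> [?C]\<^bsup>r\<^esup>)"
      by (simp add: finite_imp_finite_nsets)
    show "cliques r G \<subseteq> (\<lambda>(v, Y). insert v Y) ` ({..<n} \<times> [?C]\<^bsup>(r - 1)\<^esup>) \<union> [?C]\<^bsup>r\<^esup>"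
    proof
      fix X assume "X \<in> cliques r G"
      then have X: "is_clique G X" "card X = r" by (auto simp: cliques_def)
      have fin: "finite X" by (rule clique_finite[OF G X(1)])
      show "X \<in> (\<lambda>(v, Y). insert v Y) ` ({..<n} \<times> [?C]\<^bsup>(r - 1)\<^esup>) \<union> [?C]\<^bsup>r\<^esup>"
      proof (cases "X \<subseteq> ?C")
        case True
        then show ?thesis using X(2) fin by (simp add: nsets_def)
      next
        case False
        then obtain v where v: "v \<in> X" "v \<notin> ?C" by blast
        have "X - {v} \<subseteq> ?C"
          using X(1) v unfolding is_clique_def E by auto
        moreover have "card (X - {v}) = r - 1" using X(2) v fin by simp
        moreover have "v < n" using X(1) v unfolding is_clique_def V by auto
        ultimately show ?thesis
          using v fin by (intro UnI1 image_eqI[of _ _ "(v, X - {v})"]) (auto simp: nsets_def)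
      qed
    qed
  qed
  also have "\<dots> \<le> card ({..<n} \<times> [?C]\<^bsup>(r - 1)\<^esup>) + card ([?C]\<^bsup>r\<^esup>)"
    by (intro order_trans[OF card_Un_le] add_right_mono card_image_le)
       (simp add: finite_imp_finite_nsets)
  also have "\<dots> = n * ((s - 2) choose (r - 1)) + ((s - 2) choose r)"
    by (simp add: card_cartesian_product card_nsets)
  finally show ?thesis .
qed

section \<open>Tools for the lower bound\<close>

text \<open>Greedy extension: a clique with fewer than \<open>r\<close> vertices excludes at most
  \<open>r * m\<close> elements of \<open>A\<close>, so another vertex of \<open>A\<close> is
  adjacent to all of it.\<close>

lemma clique_extend_in_dense_set:
  assumes G: "simple_graph G" and A: "A \<subseteq> fst G"
    and few: "\<And>v. v \<in> A \<Longrightarrow> card {u \<in> A. {v, u} \<notin> snd G} \<le> m"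
    and big: "r * m < card A"
    and X: "is_clique G X" "X \<subseteq> A" "card X \<le> r"
  shows "\<exists>Y. X \<subseteq> Y \<and> is_clique G Y \<and> card Y = r"
  using X
proof (induction "r - card X" arbitrary: X)
  case 0
  then show ?case by auto
next
  case (Suc k)
  have finA: "finite A" using G A unfolding simple_graph_def by (auto intro: finite_subset)
  have finX: "finite X" using Suc.prems finA by (auto intro: finite_subset)
  let ?B = "\<Union>v\<in>X. {u \<in> A. {v, u} \<notin> snd G}"
  have "card ?B \<le> (\<Sum>v\<in>X. card {u \<in> A. {v, u} \<notin> snd G})"
    by (rule card_UN_le[OF finX])
  also have "\<dots> \<le> card X * m"
    using few Suc.prems(2) sum_bounded_above[of X "\<lambda>v. card {u \<in> A. {v, u} \<notin> snd G}" m] by auto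
  also have "\<dots> \<le> r * m" using Suc.prems(3) by simp
  finally have "card ?B < card A" using big by simp
  moreover have "finite ?B" using finA finX by auto
  ultimately have "\<not> A \<subseteq> ?B" using card_mono[of ?B A] by linarith
  then obtain w where w: "w \<in> A" "w \<notin> ?B" unfolding subset_iff by blast
  have wE: "{v, w} \<in> snd G" if "v \<in> X" for v using w that by auto
  \<comment> \<open>There are no loops, so every vertex counts as its own non-neighbour; hence
    avoiding \<open>?B\<close> already puts \<open>w\<close> outside \<open>X\<close>.\<close>
  have "{w, w} \<notin> snd G"
    using G nsets_2_pair[of w w "fst G"] unfolding simple_graph_def by blast
  then have "w \<notin> X" using wE by metis
  then have "card (insert w X) = Suc (card X)" using finX by simp
  moreover have "is_clique G (insert w X)"
    using Suc.prems(1) w(1) A wE unfolding clique_insert by (auto simp: insert_commute)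
  moreover have "k = r - Suc (card X)" "Suc (card X) \<le> r" using Suc.hyps(2) by linarith+
  ultimately have "\<exists>Y. insert w X \<subseteq> Y \<and> is_clique G Y \<and> card Y = r"
    using Suc.prems(2) w(1) by (intro Suc.hyps(1)) simp_all
  then show ?case by blast
qed

text \<open>A substitute for the neighbourhood: edges in no \<open>r\<close>-clique are ignored, so
  the size is controlled by the number of \<open>r\<close>-cliques through \<open>v\<close>. It
  contains \<open>v\<close> itself once \<open>v\<close> lies in an \<open>r\<close>-clique.\<close>

definition near :: "nat \<Rightarrow> 'a graph \<Rightarrow> 'a \<Rightarrow> 'a set" where
  "near r G v = \<Union>{X \<in> cliques r G. v \<in> X}"

lemma card_near_le:
  assumes "card {X \<in> cliques r G. v \<in> X} \<le> K"
  shows "card (near r G v) \<le> K * r"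
proof -
  have "card (near r G v) \<le> (\<Sum>X\<in>{X \<in> cliques r G. v \<in> X}. card X)"
    unfolding near_def by (rule card_Union_le_sum_card)
  also have "\<dots> = card {X \<in> cliques r G. v \<in> X} * r"
    by (simp add: cliques_def)
  finally show ?thesis using assms by (meson le_trans mult_le_mono1)
qed

lemma finite_near: "simple_graph G \<Longrightarrow> finite (near r G v)"
  by (rule finite_subset[of _ "fst G"])
     (auto simp: near_def cliques_def is_clique_def simple_graph_def)

lemma clique_imp_near:
  assumes "simple_graph G" "is_clique G Z" "v \<in> Z" "w \<in> Z" "2 \<le> r" "r \<le> card Z"
  shows "w \<in> near r G v"
proof -
  have "card {v, w} \<le> r" using \<open>2 \<le> r\<close> by (simp add: card_insert_if)
  then obtain Y where "{v, w} \<subseteq> Y" "Y \<subseteq> Z" "card Y = r"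
    using exists_subset_between[of "{v, w}" r Z] assms clique_finite by blast
  then show ?thesis
    using clique_subset[OF assms(2)] unfolding near_def cliques_def by blast
qed

text \<open>Double counting of incidences: each clique has \<open>r\<close> vertices, and each
  vertex counted on the left lies in at least \<open>K\<close> cliques.\<close>

lemma card_vertices_in_many_cliques:
  assumes G: "simple_graph G"
  shows "K * card {v \<in> fst G. K \<le> card {X \<in> cliques r G. v \<in> X}} \<le> r * card (cliques r G)"
proof -
  let ?D = "{v \<in> fst G. K \<le> card {X \<in> cliques r G. v \<in> X}}"
  have fin: "finite (fst G)" using G by (simp add: simple_graph_def)
  have "K * card ?D \<le> (\<Sum>v\<in>?D. card {X \<in> cliques r G. v \<in> X})"
    using sum_bounded_below[of ?D K "\<lambda>v. card {X \<in> cliques r G. v \<in> X}"] by (simp add: mult.commute)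
  also have "\<dots> \<le> (\<Sum>v\<in>fst G. card {X \<in> cliques r G. v \<in> X})"
    using fin by (intro sum_mono2) auto
  also have "\<dots> = r * card (cliques r G)"
  proof (rule sum_multicount[OF fin finite_cliques[OF G]], rule ballI)
    fix X assume "X \<in> cliques r G"
    then show "card {v \<in> fst G. v \<in> X} = r"
      unfolding cliques_def is_clique_def by (auto simp: Int_absorb1 Collect_conj_eq)
  qed
  finally show ?thesis .
qed

section \<open>The lower bound for a fixed threshold\<close>

text \<open>The vertices split into \<open>D\<close>, the set \<open>B\<close> whose members account
  for \<open>M\<close> cliques each, and a remainder \<open>A\<close> of size bounded in terms of
  \<open>K\<close> and \<open>r\<close>. For fixed parameters, \<open>card D\<close> is the only
  error term that can grow with the graph.\<close>

lemma card_cliques_lower: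
  fixes G :: "'a graph" and K r s :: nat
  assumes G: "simple_graph G" and sat: "strongly_saturated (complete_graph s) G"
    and r: "2 \<le> r" and s: "r < s"
  defines "m \<equiv> K * r * (K * r) + 1"
    and "D \<equiv> {v \<in> fst G. K \<le> card {X \<in> cliques r G. v \<in> X}}"
    and "M \<equiv> (s - 2) choose (r - 1)"
  shows "M * card (fst G) \<le> card (cliques r G) + M * (card D + (r * m + m + K * r))"
proof -
  let ?V = "fst G"
  have fin: "finite ?V" using G by (simp add: simple_graph_def)
  define good where
    "good v \<longleftrightarrow> (\<exists>T\<subseteq>D. card T = s - 2 \<and> is_clique G (insert v T))" for v
  define A where "A = {v \<in> ?V - D. \<not> good v}"
  define B where "B = {v \<in> ?V - D. good v}"
  have near: "card (near r G v) \<le> K * r" if "v \<in> ?V - D" for v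
    using that by (intro card_near_le) (auto simp: D_def)
  have nonnbrs: "card {u \<in> A. {v, u} \<notin> snd G} \<le> m" if v: "v \<in> A" for v
  proof -
    \<comment> \<open>Every non-neighbour other than \<open>v\<close> is reached in two steps
      through some \<open>t\<close> outside \<open>D\<close>. Each step has at most
      \<open>K * r\<close> choices, and the \<open>+ 1\<close> in \<open>m\<close> accounts for
      \<open>v\<close> itself.\<close>
    have "{u \<in> A. {v, u} \<notin> snd G} \<subseteq> insert v (\<Union>t\<in>near r G v - D. near r G t)"
    proof
      fix u assume u: "u \<in> {u \<in> A. {v, u} \<notin> snd G}"
      show "u \<in> insert v (\<Union>t\<in>near r G v - D. near r G t)"
      proof (cases "u = v")
        case False
        have "\<exists>T. is_clique G (insert v T) \<and> is_clique G (insert u T) \<and> card T = s - 2 \<and> v \<notin> T \<and> u \<notin> T"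
          using sat u v False r s unfolding A_def
          by (subst (asm) strongly_saturated_complete_graph_iff[OF G]) auto
        then obtain T where T: "is_clique G (insert v T)" "is_clique G (insert u T)" "card T = s - 2"
          "v \<notin> T" "u \<notin> T" by blast
        have "finite T" using clique_finite[OF G T(1)] by simp
        \<comment> \<open>Both sets have \<open>s - 1\<close> elements, which is where
          \<open>r < s\<close> enters.\<close>
        then have card: "r \<le> card (insert v T)" "r \<le> card (insert u T)"
          using T r s by auto
        have "\<not> T \<subseteq> D" using v T unfolding A_def good_def by blast
        then obtain t where t: "t \<in> T" "t \<notin> D" by blast
        have "t \<in> near r G v" "u \<in> near r G t"
          using clique_imp_near[OF G T(1) _ _ r card(1)] clique_imp_near[OF G T(2) _ _ r card(2)] t
          by auto
        then show ?thesis using t by blast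
      qed simp
    qed
    then have "card {u \<in> A. {v, u} \<notin> snd G} \<le> card (insert v (\<Union>t\<in>near r G v - D. near r G t))"
      using finite_near[OF G] by (intro card_mono) auto
    also have "\<dots> \<le> Suc (card (\<Union>t\<in>near r G v - D. near r G t))"
      by (rule card_insert_le_m1) auto
    also have "card (\<Union>t\<in>near r G v - D. near r G t) \<le> (\<Sum>t\<in>near r G v - D. card (near r G t))"
      using finite_near[OF G] by (intro card_UN_le) auto
    also have "\<dots> \<le> card (near r G v - D) * (K * r)"
    proof -
      have "near r G v \<subseteq> ?V" by (auto simp: near_def cliques_def is_clique_def)
      then show ?thesis
        using near sum_bounded_above[of "near r G v - D" "\<lambda>t. card (near r G t)" "K * r"] by auto
    qed
    also have "\<dots> \<le> K * r * (K * r)"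
    proof (rule mult_le_mono1)
      have "card (near r G v - D) \<le> card (near r G v)"
        using finite_near[OF G] by (intro card_mono) auto
      also have "\<dots> \<le> K * r" using near v by (simp add: A_def)
      finally show "card (near r G v - D) \<le> K * r" .
    qed
    finally show ?thesis by (simp add: m_def)
  qed
  have cardA: "card A \<le> r * m + m + K * r"
  proof (rule ccontr)
    assume "\<not> ?thesis"
    \<comment> \<open>The summand \<open>r * m\<close> permits the greedy extension;
      \<open>m + K * r\<close> bounds the non-neighbours of \<open>v\<close> in \<open>A\<close>
      together with \<open>near r G v\<close>, which jointly cover \<open>A\<close>.\<close>
    then have big: "r * m + m + K * r < card A" by simp
    then obtain v where v: "v \<in> A" by fastforce
    have AV: "A \<subseteq> ?V" by (auto simp: A_def)
    have "A \<subseteq> {u \<in> A. {v, u} \<notin> snd G} \<union> near r G v"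
    proof
      fix u assume u: "u \<in> A"
      show "u \<in> {u \<in> A. {v, u} \<notin> snd G} \<union> near r G v"
      proof (cases "{v, u} \<in> snd G")
        case True
        then have "is_clique G {v, u}"
          using u v AV by (auto simp: is_clique_def insert_commute)
        moreover have "card {v, u} \<le> r" using r by (simp add: card_insert_if)
        ultimately obtain Y where "{v, u} \<subseteq> Y" "is_clique G Y" "card Y = r"
          using clique_extend_in_dense_set[OF G AV nonnbrs, of r "{v, u}"] u v big by auto
        then show ?thesis by (auto simp: near_def cliques_def)
      qed (use u in simp)
    qed
    then have "card A \<le> card ({u \<in> A. {v, u} \<notin> snd G} \<union> near r G v)"
      using finite_near[OF G] AV fin by (intro card_mono) (auto intro: finite_subset)
    also have "\<dots> \<le> card {u \<in> A. {v, u} \<notin> snd G} + card (near r G v)" by (rule card_Un_le)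
    also have "\<dots> \<le> m + K * r" using nonnbrs[OF v] near[of v] v by (intro add_mono) (auto simp: A_def)
    finally show False using big by simp
  qed
  have "\<forall>v\<in>B. \<exists>T. T \<subseteq> D \<and> card T = s - 2 \<and> is_clique G (insert v T)"
    unfolding B_def good_def by blast
  from bchoice[OF this] obtain T where
    "\<forall>v\<in>B. T v \<subseteq> D \<and> card (T v) = s - 2 \<and> is_clique G (insert v (T v))" by (rule exE)
  then have T: "T v \<subseteq> D \<and> card (T v) = s - 2 \<and> is_clique G (insert v (T v))" if "v \<in> B" for v
    using that by (rule bspec)
  have finD: "finite D" using fin by (simp add: D_def)
  have finT: "finite (T v)" if "v \<in> B" for v using T[OF that] finD by (auto intro: finite_subset)
  \<comment> \<open>Each pair consists of a vertex of \<open>B\<close> and \<open>r - 1\<close>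
    vertices of its chosen clique in \<open>D\<close>; the map to \<open>insert v Y\<close> injects
    these pairs into the \<open>r\<close>-cliques.\<close>
  let ?S = "SIGMA v:B. [T v]\<^bsup>(r - 1)\<^esup>"
  have "card ?S = (\<Sum>v\<in>B. card ([T v]\<^bsup>(r - 1)\<^esup>))"
    using fin finT by (intro card_SigmaI) (auto simp: B_def finite_imp_finite_nsets)
  also have "\<dots> = M * card B"
    using T by (simp add: card_nsets M_def)
  finally have "M * card B = card ?S" ..
  also have "\<dots> = card ((\<lambda>(v, Y). insert v Y) ` ?S)"
  proof (intro card_image[symmetric] inj_onI, clarify)
    \<comment> \<open>The vertex \<open>v\<close> is the only element of \<open>insert v Y\<close> outside \<open>D\<close>.\<close>
    fix v Y w Z assume *: "v \<in> B" "Y \<in> [T v]\<^bsup>(r - 1)\<^esup>" "w \<in> B" "Z \<in> [T w]\<^bsup>(r - 1)\<^esup>"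
      "insert v Y = insert w Z"
    then have "Y \<subseteq> D" "Z \<subseteq> D" "v \<notin> D" "w \<notin> D"
      using T unfolding nsets_def B_def by blast+
    then have "insert v Y - D = {v}" "insert w Z - D = {w}" "Y = insert v Y \<inter> D" "Z = insert w Z \<inter> D"
      by blast+
    then show "v = w \<and> Y = Z" using *(5) by (metis singleton_inject)
  qed
  also have "\<dots> \<le> card (cliques r G)"
  proof (intro card_mono finite_cliques[OF G], clarify)
    fix v Y assume v: "v \<in> B" and Y: "Y \<in> [T v]\<^bsup>(r - 1)\<^esup>"
    have "v \<notin> Y" using T[OF v] Y v by (auto simp: nsets_def B_def)
    then show "insert v Y \<in> cliques r G"
      using clique_subset[of G "insert v (T v)" "insert v Y"] T[OF v] Y r
      by (auto simp: cliques_def nsets_def)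
  qed
  finally have B: "M * card B \<le> card (cliques r G)" .
  have "?V = B \<union> (D \<union> A)" by (auto simp: A_def B_def D_def)
  then have "card ?V \<le> card B + (card D + card A)"
    by (metis (no_types) card_Un_le add_left_mono order_trans)
  then have "M * card ?V \<le> M * (card B + (card D + (r * m + m + K * r)))"
    using cardA by (intro mult_le_mono2) simp
  then show ?thesis using B by (simp add: add_mult_distrib2)
qed

section \<open>Passage to the limit\<close>

theorem theorem1p4:
  fixes r s :: nat
  assumes "2 \<le> r" and "r < s"
  shows "(\<lambda>n. real n * real ((s - 2) choose (r - 1))
             - real (ssat n (complete_graph r) (complete_graph s))) \<in> o(\<lambda>n. real n)"
proof (rule landau_o.smallI)
  fix c :: real assume c: "c > 0"
  define M where "M = (s - 2) choose (r - 1)"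
  define N where "N n = ssat n (complete_graph r) (complete_graph s)" for n
  \<comment> \<open>Chosen so that \<open>d \<le> r * N n / K\<close> and
    \<open>N n \<le> M * n\<close> give \<open>M * d \<le> c / 2 * n\<close>.\<close>
  obtain K :: nat where K: "real K > 2 * (real M * real r * real M) / c"
    using reals_Archimedean2 by blast
  have K0: "real K > 0" using K c
    by (smt (verit) divide_nonneg_pos mult_nonneg_nonneg of_nat_0_le_iff)
  define m where "m = K * r * (K * r) + 1"
  define b where "b = r * m + m + K * r"
  have lower: "real n * real M - real (N n) \<le> c / 2 * real n + real (M * b)" for n
  \<comment> \<open>If \<open>N n\<close> exceeds \<open>M * n\<close>, the left side is negative.
    Otherwise the number of cliques is linear in \<open>n\<close>, as needed to bound
    \<open>d\<close>.\<close>
  proof (cases "N n \<le> M * n")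
    case False
    then have "real (M * n) < real (N n)" by linarith
    moreover have "0 \<le> c / 2 * real n + real (M * b)" using c by simp
    ultimately show ?thesis by (simp add: mult.commute)
  next
    case True
    obtain G :: "nat graph" where G: "simple_graph G" "card (fst G) = n"
      "strongly_saturated (complete_graph s) G" "card (copies (complete_graph r) G) = N n"
      using ssat_attained[of n "complete_graph s" "complete_graph r"] unfolding N_def by blast
    have N: "card (cliques r G) = N n"
      using G card_copies_complete_graph by metis
    define d where "d = card {v \<in> fst G. K \<le> card {X \<in> cliques r G. v \<in> X}}"
    have 1: "M * n \<le> N n + M * (d + b)"
      using card_cliques_lower[OF G(1,3) assms, of K] unfolding G N M_def m_def b_def d_def by simp
    have "K * d \<le> r * N n"
      using card_vertices_in_many_cliques[OF G(1), of K r] unfolding N d_def .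
    also have "\<dots> \<le> r * (M * n)" using True by simp
    finally have "real (K * d) \<le> real (r * (M * n))" by (simp only: of_nat_le_iff)
    then have "real M * (real K * real d) \<le> real M * (real r * real M * real n)"
      by (intro mult_left_mono) (simp_all add: mult.assoc)
    also have "\<dots> = real M * real r * real M * real n" by simp
    also have "\<dots> \<le> (c / 2 * real K) * real n"
      using K c by (intro mult_right_mono) (simp_all add: field_simps)
    finally have "real K * (real M * real d) \<le> real K * (c / 2 * real n)"
      by (simp add: algebra_simps)
    then have 2: "real M * real d \<le> c / 2 * real n" using K0 by simp
    have "real (M * n) \<le> real (N n + M * (d + b))" using 1 by (simp only: of_nat_le_iff)
    then show ?thesis using 2 by (simp add: algebra_simps)
  qed
  have upper: "real (N n) - real n * real M \<le> real ((s - 2) choose r)" for n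
  proof -
    have "N n \<le> n * M + ((s - 2) choose r)"
      unfolding N_def M_def using assms by (intro ssat_complete_graph_upper) auto
    then have "real (N n) \<le> real (n * M + ((s - 2) choose r))" by (simp only: of_nat_le_iff)
    then show ?thesis by simp
  qed
  \<comment> \<open>\<open>q\<close> dominates the additive constants of both bounds; once
    \<open>n\<close> is at least \<open>2 * q / c\<close>, it fits into the remaining
    \<open>c / 2 * n\<close>.\<close>
  define q where "q = real (M * b) + real ((s - 2) choose r)"
  have "eventually (\<lambda>n::nat. 2 * q / c \<le> real n) at_top"
    using eventually_ge_at_top[of "nat \<lceil>2 * q / c\<rceil>"] by eventually_elim linarith
  then show "\<forall>\<^sub>F n in at_top. norm (real n * real ((s - 2) choose (r - 1))
      - real (ssat n (complete_graph r) (complete_graph s))) \<le> c * norm (real n)"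
  proof eventually_elim
    case (elim n)
    then have "q \<le> c / 2 * real n" using c by (simp add: field_simps)
    moreover have "0 \<le> real (M * b)" "0 \<le> real ((s - 2) choose r)" "0 \<le> c / 2 * real n"
      using c by simp_all
    ultimately have "\<bar>real n * real M - real (N n)\<bar> \<le> c * real n"
      using lower[of n] upper[of n] unfolding q_def by linarith
    then show ?case unfolding M_def N_def by simp
  qed
qed

end
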